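(* Let $P\in\mathbb{H}_{\rm coq}[x]$ be a monic polynomial of degree $n$ whose companion polynomial $\mathcal C_P$ has $m$ real simple zeros $r_1,r_2,\dots,r_m$, $m\le 2n$, and let $P_r(x)=P(x)(x-r)$ with $r\in\mathbb{R}$, $r\neq r_i$ for $i=1,\dots,m$. Then $P_r(x)$ has at least $m$ linear zeros.
   Context: $\mathbb{H}_{\rm coq}$ denotes the real algebra of coquaternions (split quaternions): the $4$-dimensional associative real algebra with basis $1,\mathbf i,\mathbf j,\mathbf k$ and multiplication $\mathbf i^2=-1$, $\mathbf j^2=\mathbf k^2=1$, $\mathbf i\mathbf j=-\mathbf j\mathbf i=\mathbf k$. For $q=q_0+q_1\mathbf i+q_2\mathbf j+q_3\mathbf k$: $\mathrm{Re}(q)=q_0$, $\overline q=q_0-q_1\mathbf i-q_2\mathbf j-q_3\mathbf k$, $\mathrm{dv}(q)=q_1^2-q_2^2-q_3^2$. The quasi-similarity class of $q$ is $[\![q]\!]=\{p\in\mathbb{H}_{\rm coq}:\mathrm{Re}(p)=\mathrm{Re}(q),\ \mathrm{dv}(p)=\mathrm{dv}(q)\}$. $\mathbb{H}_{\rm coq}[x]$ is the ring of polynomials $\sum_i c_ix^i$ with coefficients $c_i\in\mathbb{H}_{\rm coq}$ on the left, with the usual addition and multiplication in which the variable $x$ commutes with the coefficients. The evaluation at $z\in\mathbb{H}_{\rm coq}$ is $P(z)=\sum_i c_iz^i$, and $z$ is a zero of $P$ if $P(z)=0$. The conjugate $\overline P$ of $P$ is obtained by conjugating all coefficients, and the companion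 polynomial of $P$ is $\mathcal C_P=P\overline P=\overline PP$, which has real coefficients; its real simple zeros are its distinct real roots of multiplicity one as a real polynomial. A zero $z$ of a polynomial is isolated if $[\![z]\!]$ contains no other zeros of that polynomial; hyperboloidal if every element of $[\![z]\!]$ is a zero; linear if it is neither isolated nor hyperboloidal. When counting zeros, all zeros belonging to the same quasi-similarity class are treated as forming a single zero; thus "at least $m$ linear zeros" means that at least $m$ distinct quasi-similarity classes contain linear zeros. *)

theory Defs
  imports Complex_Main "HOL-Library.Poly_Mapping" "HOL-Computational_Algebra.Polynomial"
begin

section \<open>Coquaternions\<close>

codatatype coquat = Coquat (coq_re: real) (coq_i: real) (coq_j: real) (coq_k: real)

lemma coquat_eq_iff:
  "x = y \<longleftrightarrow> coq_re x = coq_re y \<and> coq_i x = coq_i y \<and> coq_j x = coq_j y \<and> coq_k x = coq_k y"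
  by (auto intro: coquat.expand)

instantiation coquat :: real_algebra_1
begin

primcorec zero_coquat where
  "coq_re 0 = 0" | "coq_i 0 = 0" | "coq_j 0 = 0" | "coq_k 0 = 0"

primcorec one_coquat where
  "coq_re 1 = 1" | "coq_i 1 = 0" | "coq_j 1 = 0" | "coq_k 1 = 0"

primcorec plus_coquat where
  "coq_re (x + y) = coq_re x + coq_re y"
| "coq_i (x + y) = coq_i x + coq_i y"
| "coq_j (x + y) = coq_j x + coq_j y"
| "coq_k (x + y) = coq_k x + coq_k y"

primcorec uminus_coquat where
  "coq_re (- x) = - coq_re x"
| "coq_i (- x) = - coq_i x"
| "coq_j (- x) = - coq_j x"
| "coq_k (- x) = - coq_k x"

primcorec minus_coquat where
  "coq_re (x - y) = coq_re x - coq_re y"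
| "coq_i (x - y) = coq_i x - coq_i y"
| "coq_j (x - y) = coq_j x - coq_j y"
| "coq_k (x - y) = coq_k x - coq_k y"

primcorec scaleR_coquat where
  "coq_re (scaleR r x) = r * coq_re x"
| "coq_i (scaleR r x) = r * coq_i x"
| "coq_j (scaleR r x) = r * coq_j x"
| "coq_k (scaleR r x) = r * coq_k x"

text \<open>The multiplication table on basis elements is verified in \<open>coquat_basis_mult\<close> below.\<close>

primcorec times_coquat where
  "coq_re (x * y) = coq_re x * coq_re y - coq_i x * coq_i y + coq_j x * coq_j y + coq_k x * coq_k y"
| "coq_i (x * y) = coq_re x * coq_i y + coq_i x * coq_re y - coq_j x * coq_k y + coq_k x * coq_j y"
| "coq_j (x * y) = coq_re x * coq_j y + coq_j x * coq_re y + coq_k x * coq_i y - coq_i x * coq_k y"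
| "coq_k (x * y) = coq_re x * coq_k y + coq_k x * coq_re y + coq_i x * coq_j y - coq_j x * coq_i y"

instance
  by standard (simp_all add: coquat_eq_iff algebra_simps)

end

lemma coquat_basis_mult:
  fixes i j k :: coquat
  defines "i \<equiv> Coquat 0 1 0 0" and "j \<equiv> Coquat 0 0 1 0" and "k \<equiv> Coquat 0 0 0 1"
  shows "i * i = - 1" and "j * j = 1" and "k * k = 1" and "i * j = k" and "j * i = - k"
  by (simp_all add: coquat_eq_iff i_def j_def k_def)

lemma coq_of_real [simp]:
  "coq_re (of_real r) = r" "coq_i (of_real r) = 0" "coq_j (of_real r) = 0" "coq_k (of_real r) = 0"
  by (simp_all add: of_real_def)

definition coq_cnj :: "coquat \<Rightarrow> coquat" where
  "coq_cnj q = Coquat (coq_re q) (- coq_i q) (- coq_j q) (- coq_k q)"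

lemma coq_cnj_sel [simp]:
  "coq_re (coq_cnj q) = coq_re q" "coq_i (coq_cnj q) = - coq_i q"
  "coq_j (coq_cnj q) = - coq_j q" "coq_k (coq_cnj q) = - coq_k q"
  by (simp_all add: coq_cnj_def)

definition coq_dv :: "coquat \<Rightarrow> real" where
  "coq_dv q = (coq_i q)\<^sup>2 - (coq_j q)\<^sup>2 - (coq_k q)\<^sup>2"

definition qsim_class :: "coquat \<Rightarrow> coquat set" where
  "qsim_class q = {p. coq_re p = coq_re q \<and> coq_dv p = coq_dv q}"

section \<open>Polynomials over the coquaternions\<close>

text \<open>
  The multiplication of the library type \<^typ>\<open>'a poly\<close> is only available over commutative
  rings. The type \<^typ>\<open>nat \<Rightarrow>\<^sub>0 coquat\<close> carries the convolution product over
  arbitrary rings, so it is the polynomial ring in a variable commuting with all coefficients.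
\<close>

type_synonym coqpoly = "nat \<Rightarrow>\<^sub>0 coquat"

definition coqpoly_eval :: "coqpoly \<Rightarrow> coquat \<Rightarrow> coquat" where
  "coqpoly_eval P z = (\<Sum>i\<in>Poly_Mapping.keys P. Poly_Mapping.lookup P i * z ^ i)"

definition monic_of_degree :: "nat \<Rightarrow> coqpoly \<Rightarrow> bool" where
  "monic_of_degree n P \<longleftrightarrow>
     Poly_Mapping.lookup P n = 1 \<and> (\<forall>k>n. Poly_Mapping.lookup P k = 0)"

definition linear_factor :: "coquat \<Rightarrow> coqpoly" where
  "linear_factor a = Poly_Mapping.single 1 1 - Poly_Mapping.single 0 a"

definition coqpoly_cnj :: "coqpoly \<Rightarrow> coqpoly" where
  "coqpoly_cnj P = Poly_Mapping.map coq_cnj P"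

definition companion :: "coqpoly \<Rightarrow> coqpoly" where
  "companion P = P * coqpoly_cnj P"

text \<open>
  The companion polynomial as a real polynomial, obtained from the real parts of its coefficients.
  Nothing is lost: \<open>lookup_companion\<close> below shows that the coefficients are real.
\<close>

definition real_companion :: "coqpoly \<Rightarrow> real poly" where
  "real_companion P =
     (\<Sum>i\<in>Poly_Mapping.keys (companion P). monom (coq_re (Poly_Mapping.lookup (companion P) i)) i)"

definition real_simple_zeros :: "coqpoly \<Rightarrow> real set" where
  "real_simple_zeros P = {x. poly (real_companion P) x = 0 \<and> order x (real_companion P) = 1}"

section \<open>Types of zeros\<close>

definition coq_zero :: "coqpoly \<Rightarrow> coquat \<Rightarrow> bool" where
  "coq_zero P z \<longleftrightarrow> coqpoly_eval P z = 0"

definition isolated_zero :: "coqpoly \<Rightarrow> coquat \<Rightarrow> bool" where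
  "isolated_zero P z \<longleftrightarrow> coq_zero P z \<and> (\<forall>w\<in>qsim_class z. coq_zero P w \<longrightarrow> w = z)"

definition hyperboloidal_zero :: "coqpoly \<Rightarrow> coquat \<Rightarrow> bool" where
  "hyperboloidal_zero P z \<longleftrightarrow> coq_zero P z \<and> (\<forall>w\<in>qsim_class z. coq_zero P w)"

definition linear_zero :: "coqpoly \<Rightarrow> coquat \<Rightarrow> bool" where
  "linear_zero P z \<longleftrightarrow> coq_zero P z \<and> \<not> isolated_zero P z \<and> \<not> hyperboloidal_zero P z"

text \<open>
  Zeros are counted by quasi-similarity class. The count is phrased with a finite subset, so that
  it is also meaningful if infinitely many classes contain linear zeros.
\<close>

definition at_least_linear_zeros :: "nat \<Rightarrow> coqpoly \<Rightarrow> bool" where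
  "at_least_linear_zeros m P \<longleftrightarrow>
     (\<exists>S \<subseteq> {qsim_class z | z. linear_zero P z}. finite S \<and> card S = m)"

section \<open>The companion polynomial is well defined\<close>

lemma coq_cnj_simps:
  "coq_cnj 0 = 0" "coq_cnj (x + y) = coq_cnj x + coq_cnj y"
  "coq_cnj (x * y) = coq_cnj y * coq_cnj x" "coq_cnj (coq_cnj x) = x"
  by (simp_all add: coquat_eq_iff algebra_simps)

lemma lookup_coqpoly_cnj: "Poly_Mapping.lookup (coqpoly_cnj P) i = coq_cnj (Poly_Mapping.lookup P i)"
  unfolding coqpoly_cnj_def by transfer (simp add: when_def coq_cnj_simps)

lemma lookup_mult_nat:
  fixes P Q :: "nat \<Rightarrow>\<^sub>0 'a::semiring_0"
  shows "Poly_Mapping.lookup (P * Q) n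
    = (\<Sum>i\<le>n. Poly_Mapping.lookup P i * Poly_Mapping.lookup Q (n - i))"
proof -
  have *: "Sum_any (\<lambda>q. Poly_Mapping.lookup Q q when n = l + q)
      = (if l \<le> n then Poly_Mapping.lookup Q (n - l) else 0)" for l
  proof (cases "l \<le> n")
    case True
    then have "(\<lambda>q. Poly_Mapping.lookup Q q when n = l + q)
        = (\<lambda>q. Poly_Mapping.lookup Q q when q = n - l)"
      by (auto simp: when_def fun_eq_iff)
    then show ?thesis
      by (simp only: True if_True Sum_any_when_equal)
  qed (auto simp: when_def)
  have "Poly_Mapping.lookup (P * Q) n
      = Sum_any (\<lambda>l. Poly_Mapping.lookup P l * (if l \<le> n then Poly_Mapping.lookup Q (n - l) else 0))"
    by (simp add: lookup_mult *)
  also have "\<dots> = (\<Sum>l\<le>n. Poly_Mapping.lookup P l * (if l \<le> n then Poly_Mapping.lookup Q (n - l) else 0))"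
    by (rule Sum_any.expand_superset) (auto split: if_splits)
  finally show ?thesis by simp
qed

lemma coq_cnj_sum: "coq_cnj (sum f A) = (\<Sum>i\<in>A. coq_cnj (f i))"
  by (induction A rule: infinite_finite_induct) (auto simp: coq_cnj_simps)

lemma sum_flip: "(\<Sum>i\<le>n. f (n - i) i) = (\<Sum>i\<le>(n::nat). f i (n - i))"
  by (rule sum.reindex_bij_witness[where i = "\<lambda>i. n - i" and j = "\<lambda>i. n - i"]) auto

lemma companion_commute: "coqpoly_cnj P * P = companion P"
proof (rule poly_mapping_eqI)
  fix n
  let ?a = "Poly_Mapping.lookup P"
  have comm: "coq_cnj x * y + coq_cnj y * x = y * coq_cnj x + x * coq_cnj y" for x y
    by (simp add: coquat_eq_iff algebra_simps)
  have "2 *\<^sub>R (\<Sum>i\<le>n. coq_cnj (?a i) * ?a (n - i))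
      = (\<Sum>i\<le>n. coq_cnj (?a i) * ?a (n - i) + coq_cnj (?a (n - i)) * ?a i)"
    by (simp add: sum.distrib scaleR_2 sum_flip[of "\<lambda>x y. coq_cnj (?a x) * ?a y"])
  also have "\<dots> = (\<Sum>i\<le>n. ?a (n - i) * coq_cnj (?a i) + ?a i * coq_cnj (?a (n - i)))"
    by (simp add: comm)
  also have "\<dots> = 2 *\<^sub>R (\<Sum>i\<le>n. ?a i * coq_cnj (?a (n - i)))"
    by (simp add: sum.distrib scaleR_2 sum_flip[of "\<lambda>x y. ?a x * coq_cnj (?a y)"])
  finally show "Poly_Mapping.lookup (coqpoly_cnj P * P) n = Poly_Mapping.lookup (companion P) n"
    by (simp add: companion_def lookup_mult_nat lookup_coqpoly_cnj)
qed

lemma coeff_real_companion: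
  "coeff (real_companion P) i = coq_re (Poly_Mapping.lookup (companion P) i)"
  by (auto simp: real_companion_def coeff_sum if_distrib sum.delta in_keys_iff)

lemma lookup_companion:
  "Poly_Mapping.lookup (companion P) n = of_real (coeff (real_companion P) n)"
proof -
  let ?a = "Poly_Mapping.lookup P"
  have "coq_cnj (Poly_Mapping.lookup (companion P) n) = (\<Sum>i\<le>n. ?a (n - i) * coq_cnj (?a i))"
    by (simp add: companion_def lookup_mult_nat lookup_coqpoly_cnj coq_cnj_sum coq_cnj_simps)
  also have "\<dots> = Poly_Mapping.lookup (companion P) n"
    by (simp add: companion_def lookup_mult_nat lookup_coqpoly_cnj
        sum_flip[of "\<lambda>x y. ?a x * coq_cnj (?a y)"])
  finally show ?thesis
    by (simp add: coquat_eq_iff coeff_real_companion)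
qed

end

(* If s is a simple real zero of the companion polynomial, then P(s) is a nonzero coquaternion of
   vanishing norm: a double factor would appear if P(s) = 0. For z with (z - s) (z - r) = 0 one has
   z^i (z - r) = s^i (z - r), so that P_r(z) = P(z) (z - r) = P(s) (z - r). Writing such a z as
   (r + s)/2 + ((s - r)/2) u with u pure and u^2 = 1, the condition P_r(z) = 0 becomes
   P(s) u = - P(s). This has more than one solution u, but if u is a solution then - u is not.
   The resulting classes have real part (r + s)/2, so they are distinct for distinct s. *)

theory Submission
  imports Defs
begin

text \<open>The right-hand side is the indefinite norm of \<open>q\<close>. Every later assumption
  that it vanishes says that \<open>q\<close> is null, so that \<open>q\<close> and
  \<open>coq_cnj q\<close> annihilate each other.\<close>

lemma coq_mult_cnj:
  "q * coq_cnj q = of_real ((coq_re q)\<^sup>2 + coq_dv q)"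
  "coq_cnj q * q = of_real ((coq_re q)\<^sup>2 + coq_dv q)"
  by (simp_all add: coquat_eq_iff coq_dv_def power2_eq_square algebra_simps)

lemma pure_square: "coq_re u = 0 \<Longrightarrow> u * u = of_real (- coq_dv u)"
  by (simp add: coquat_eq_iff coq_dv_def power2_eq_square algebra_simps)

section \<open>Evaluation\<close>

lemma coqpoly_eval_superset:
  assumes "finite A" "Poly_Mapping.keys P \<subseteq> A"
  shows "coqpoly_eval P z = (\<Sum>i\<in>A. Poly_Mapping.lookup P i * z ^ i)"
  unfolding coqpoly_eval_def
  by (rule sum.mono_neutral_left) (use assms in \<open>auto simp: in_keys_iff\<close>)

lemma coqpoly_eval_diff: "coqpoly_eval (P - Q) z = coqpoly_eval P z - coqpoly_eval Q z"
proof -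
  let ?A = "Poly_Mapping.keys P \<union> Poly_Mapping.keys Q"
  have "Poly_Mapping.keys (P - Q) \<subseteq> ?A"
    by (auto simp: in_keys_iff lookup_minus)
  then show ?thesis
    by (subst (1 2 3) coqpoly_eval_superset[of ?A])
      (auto simp: lookup_minus sum_subtractf algebra_simps)
qed

lemma coqpoly_eval_add: "coqpoly_eval (P + Q) z = coqpoly_eval P z + coqpoly_eval Q z"
  using coqpoly_eval_diff[of "P + Q" Q z] by simp

lemma coqpoly_eval_single: "coqpoly_eval (Poly_Mapping.single k c) z = c * z ^ k"
  by (subst coqpoly_eval_superset[of "{k}"]) auto

text \<open>Evaluation is not multiplicative in general. It is here because \<open>of_real r\<close>
  is central and so commutes with the powers of \<open>z\<close>.\<close>

lemma coqpoly_eval_mult_linear_factor: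
  "coqpoly_eval (P * linear_factor (of_real r)) z = coqpoly_eval P z * (z - of_real r)"
proof (induction P rule: update_induct)
  case const
  show ?case
    by (simp add: coqpoly_eval_def)
next
  case (update P k c)
  have "of_real r * z ^ k = z ^ k * of_real r"
    by (simp add: of_real_def)
  then have single: "coqpoly_eval (Poly_Mapping.single k c * linear_factor (of_real r)) z
      = coqpoly_eval (Poly_Mapping.single k c) z * (z - of_real r)"
    using power_Suc2[of z k]
    by (simp add: linear_factor_def right_diff_distrib mult_single coqpoly_eval_diff
        coqpoly_eval_single mult.assoc)
  \<comment> \<open>The induction supplies an index \<open>k\<close> outside the keys of
    \<open>P\<close>, so the update overwrites no coefficient and just adds a monomial.\<close>
  have "Poly_Mapping.update k c P = P + Poly_Mapping.single k c"
    using update(1)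
    by (auto intro!: poly_mapping_eqI simp: lookup_update lookup_add lookup_single in_keys_iff)
  then show ?case
    by (simp add: distrib_right coqpoly_eval_add update.IH single)
qed

text \<open>Left multiplication by \<open>z\<close> acts on \<open>y\<close> as the central scalar
  \<open>s\<close>, hence so does each power of \<open>z\<close>.\<close>

lemma coqpoly_eval_mult_eigen:
  assumes "(z - of_real s) * y = 0"
  shows "coqpoly_eval P z * y = coqpoly_eval P (of_real s) * y"
proof -
  have zy: "z * y = of_real s * y"
    using assms by (simp add: algebra_simps)
  have "z ^ i * y = of_real s ^ i * y" for i
  proof (induction i)
    case (Suc i)
    have "z ^ Suc i * y = z ^ i * (of_real s * y)"
      by (simp only: power_Suc2 mult.assoc zy)
    also have "\<dots> = of_real s * (z ^ i * y)"
      by (simp add: of_real_def)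
    finally show ?case
      by (simp add: Suc mult.assoc)
  qed simp
  then show ?thesis
    by (simp add: coqpoly_eval_def sum_distrib_right mult.assoc)
qed

section \<open>The companion polynomial in terms of real components\<close>

text \<open>Taking \<open>f\<close> as a parameter lets the four coordinate polynomials share the
  lemmas for linear \<open>f\<close>.\<close>

definition component_poly :: "(coquat \<Rightarrow> real) \<Rightarrow> coqpoly \<Rightarrow> real poly" where
  "component_poly f P = (\<Sum>i\<in>Poly_Mapping.keys P. monom (f (Poly_Mapping.lookup P i)) i)"

lemma linear_components: "linear coq_re" "linear coq_i" "linear coq_j" "linear coq_k"
  by (auto intro!: linearI)

lemma coeff_component_poly:
  assumes "linear f"
  shows "coeff (component_poly f P) i = f (Poly_Mapping.lookup P i)"
  using linear_0[OF assms]
  by (auto simp: component_poly_def coeff_sum if_distrib sum.delta in_keys_iff)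

lemma poly_component_poly:
  assumes "linear f"
  shows "poly (component_poly f P) s = f (coqpoly_eval P (of_real s))"
proof -
  have "f (a * of_real s ^ i) = f a * s ^ i" for a i
  proof -
    have "a * of_real s ^ i = a * of_real (s ^ i)"
      by simp
    also have "\<dots> = (s ^ i) *\<^sub>R a"
      by (simp only: of_real_def mult_scaleR_right mult_1_right)
    finally have "a * of_real s ^ i = (s ^ i) *\<^sub>R a" .
    then show ?thesis
      by (simp add: linear_scale[OF assms])
  qed
  then show ?thesis
    by (simp add: component_poly_def coqpoly_eval_def poly_sum poly_monom linear_sum[OF assms])
qed

text \<open>This is the norm form applied to the four coordinate polynomials. Comparing real parts
  suffices, as \<open>real_companion\<close> is built from them.\<close>

lemma real_companion_components:
  "real_companion P = (component_poly coq_re P)\<^sup>2 + (component_poly coq_i P)\<^sup>2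
    - (component_poly coq_j P)\<^sup>2 - (component_poly coq_k P)\<^sup>2"
proof (rule poly_eqI)
  fix n
  have re_sum: "coq_re (sum g A) = (\<Sum>i\<in>A. coq_re (g i))" for g :: "nat \<Rightarrow> coquat" and A
    by (rule linear_sum[OF linear_components(1)])
  show "coeff (real_companion P) n = coeff ((component_poly coq_re P)\<^sup>2
    + (component_poly coq_i P)\<^sup>2 - (component_poly coq_j P)\<^sup>2 - (component_poly coq_k P)\<^sup>2) n"
    by (simp add: coeff_real_companion companion_def lookup_mult_nat lookup_coqpoly_cnj re_sum
        power2_eq_square coeff_mult coeff_component_poly linear_components
        sum.distrib sum_subtractf)
qed

lemma poly_real_companion:
  "poly (real_companion P) s =
    (coq_re (coqpoly_eval P (of_real s)))\<^sup>2 + coq_dv (coqpoly_eval P (of_real s))"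
  by (simp add: real_companion_components poly_component_poly linear_components coq_dv_def)

lemma real_companion_nonzero:
  assumes "monic_of_degree n P"
  shows "real_companion P \<noteq> 0"
proof -
  let ?a = "Poly_Mapping.lookup P"
  \<comment> \<open>Unless \<open>i = n\<close>, one of the two indices exceeds \<open>n\<close>,
    where the coefficient of \<open>P\<close> is zero.\<close>
  have "?a i * coq_cnj (?a (2 * n - i)) = (if i = n then 1 else 0)" if "i \<le> 2 * n" for i
  proof (cases i n rule: linorder_cases)
    case less
    then have "2 * n - i > n" by simp
    then show ?thesis
      using assms less by (simp add: monic_of_degree_def coq_cnj_simps)
  qed (use assms in \<open>auto simp: monic_of_degree_def coquat_eq_iff\<close>)
  then have "Poly_Mapping.lookup (companion P) (2 * n) = (\<Sum>i\<le>2 * n. if i = n then 1 else 0)"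
    unfolding companion_def lookup_mult_nat lookup_coqpoly_cnj by (intro sum.cong) auto
  then have "coeff (real_companion P) (2 * n) = 1"
    by (simp add: coeff_real_companion)
  then show ?thesis by auto
qed

text \<open>All four coordinate polynomials vanish at \<open>s\<close>, so each of their squares has
  a double root there.\<close>

lemma double_root_real_companion:
  assumes "coqpoly_eval P (of_real s) = 0"
  shows "[:- s, 1:]\<^sup>2 dvd real_companion P"
proof -
  have *: "[:- s, 1:]\<^sup>2 dvd (component_poly f P)\<^sup>2" if "linear f" for f
  proof -
    have "poly (component_poly f P) s = 0"
      using assms linear_0[OF that] by (simp add: poly_component_poly that)
    then show ?thesis
      by (simp add: poly_eq_0_iff_dvd dvd_power_same)
  qed
  then show ?thesis
    unfolding real_companion_components by (intro dvd_add dvd_diff *[OF linear_components(1)]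
      *[OF linear_components(2)] *[OF linear_components(3)] *[OF linear_components(4)])
qed

lemma eval_at_real_simple_zero:
  assumes "monic_of_degree n P" "s \<in> real_simple_zeros P"
  shows "coqpoly_eval P (of_real s) \<noteq> 0"
    and "(coq_re (coqpoly_eval P (of_real s)))\<^sup>2 + coq_dv (coqpoly_eval P (of_real s)) = 0"
proof -
  have ord: "order s (real_companion P) = 1" and root: "poly (real_companion P) s = 0"
    using assms(2) by (auto simp: real_simple_zeros_def)
  have "\<not> [:- s, 1:]\<^sup>2 dvd real_companion P"
    using order_2[OF real_companion_nonzero[OF assms(1)], of s] ord
    by (simp add: numeral_2_eq_2)
  then show "coqpoly_eval P (of_real s) \<noteq> 0"
    using double_root_real_companion by blast
  show "(coq_re (coqpoly_eval P (of_real s)))\<^sup>2 + coq_dv (coqpoly_eval P (of_real s)) = 0"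
    using root by (simp add: poly_real_companion)
qed

section \<open>Linear zeros\<close>

text \<open>
  Every \<open>p\<close> for which \<open>coq_cnj q * p\<close> has real part 1 gives the solution \<open>coq_cnj q * p - 1\<close>;
  the two witnesses for \<open>p\<close> below differ by \<open>\<i> q\<close>.
\<close>

lemma null_coquat_eigen:
  assumes "q \<noteq> 0" "(coq_re q)\<^sup>2 + coq_dv q = 0"
  obtains u v where "coq_re u = 0" "coq_dv u = - 1" "q * u = - q"
    "coq_re v = 0" "coq_dv v = - 1" "q * v = - q" "u \<noteq> v"
proof -
  \<comment> \<open>A vanishing norm makes this definite sum equal to the one over the other two
    coordinates, so \<open>t = 0\<close> would force \<open>q = 0\<close>.\<close>
  define t where "t = (coq_re q)\<^sup>2 + (coq_i q)\<^sup>2"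
  have t2: "(coq_j q)\<^sup>2 + (coq_k q)\<^sup>2 = t"
    using assms(2) by (simp add: t_def coq_dv_def)
  have "t \<noteq> 0"
  proof
    assume "t = 0"
    then have "q = 0"
      using t2 by (simp add: t_def coquat_eq_iff sum_power2_eq_zero_iff)
    with assms(1) show False ..
  qed
  \<comment> \<open>Normalised by \<open>t\<close>, the part of \<open>q\<close> in the span of 1
    and i gives real part 1 after multiplication by \<open>coq_cnj q\<close>.\<close>
  define p where "p = Coquat (coq_re q / t) (coq_i q / t) 0 0"
  \<comment> \<open>The added term contributes \<open>coq_cnj q\<close> * i * \<open>q\<close>. Its
    real part is that of i times the norm of \<open>q\<close>, namely 0, but its i-coordinate is
    \<open>2 * t\<close>.\<close>
  define p' where "p' = p + Coquat 0 1 0 0 * q"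
  have solution: "coq_re (coq_cnj q * x - 1) = 0" "coq_dv (coq_cnj q * x - 1) = - 1"
      "q * (coq_cnj q * x - 1) = - q" if "coq_re (coq_cnj q * x) = 1" for x
  proof -
    let ?y = "coq_cnj q * x"
    have qq: "q * coq_cnj q = 0" "coq_cnj q * q = 0"
      using assms(2) by (simp_all add: coq_mult_cnj)
    \<comment> \<open>The inner factor is real and moves out, leaving
      \<open>coq_cnj q * q = 0\<close>. So \<open>?y\<close> is null with real part 1, which fixes
      its \<open>coq_dv\<close>.\<close>
    have "?y * coq_cnj ?y = coq_cnj q * (x * coq_cnj x) * q"
      by (simp add: coq_cnj_simps mult.assoc)
    also have "\<dots> = 0"
      by (simp add: coq_mult_cnj(1)[of x] of_real_def qq del: of_real_add)
    finally have "(coq_re ?y)\<^sup>2 + coq_dv ?y = 0"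
      by (simp only: coq_mult_cnj of_real_eq_0_iff)
    then show "coq_dv (?y - 1) = - 1"
      using that by (simp add: coq_dv_def)
    show "coq_re (?y - 1) = 0" using that by simp
    show "q * (?y - 1) = - q"
      by (simp add: right_diff_distrib qq flip: mult.assoc)
  qed
  have re: "coq_re (coq_cnj q * p) = 1"
    using \<open>t \<noteq> 0\<close> by (simp add: p_def t_def power2_eq_square add_divide_distrib[symmetric])
  moreover have re': "coq_re (coq_cnj q * p') = 1"
    using re by (simp add: p'_def algebra_simps)
  moreover have "coq_i (coq_cnj q * p' - coq_cnj q * p) = 2 * t"
    using t2 by (simp add: p'_def t_def power2_eq_square algebra_simps)
  then have "coq_i (coq_cnj q * p' - coq_cnj q * p) \<noteq> 0"
    using \<open>t \<noteq> 0\<close> by simp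
  then have "coq_cnj q * p' - coq_cnj q * p \<noteq> 0"
    by (metis zero_coquat.simps(2))
  then have "coq_cnj q * p - 1 \<noteq> coq_cnj q * p' - 1"
    by simp
  ultimately show thesis
    using that solution by blast
qed

text \<open>These points are non-real roots of (x - r)(x - s) when r \<noteq> s: both differences
  are multiples of \<open>u + 1\<close> and \<open>u - 1\<close>, whose product is u^2 - 1 =
  0.\<close>

lemma eval_on_real_pair_class:
  fixes u :: coquat
  assumes "coq_re u = 0" "coq_dv u = - 1"
  shows "coqpoly_eval (P * linear_factor (of_real r)) (of_real ((r + s) / 2) + ((s - r) / 2) *\<^sub>R u)
    = ((s - r) / 2) *\<^sub>R (coqpoly_eval P (of_real s) * (u + 1))"
proof -
  let ?z = "of_real ((r + s) / 2) + ((s - r) / 2) *\<^sub>R u"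
  have zr: "?z - of_real r = ((s - r) / 2) *\<^sub>R (u + 1)"
    and zs: "?z - of_real s = ((s - r) / 2) *\<^sub>R (u - 1)"
    by (simp_all add: coquat_eq_iff field_simps)
  have "(u - 1) * (u + 1) = 0"
    using pure_square[OF assms(1)] assms(2) by (simp add: algebra_simps)
  then have "(?z - of_real s) * (?z - of_real r) = 0"
    unfolding zr zs by simp
  from coqpoly_eval_mult_eigen[OF this, of P] show ?thesis
    unfolding coqpoly_eval_mult_linear_factor zr by simp
qed

lemma linear_zero_at_simple_zero:
  assumes "monic_of_degree n P" "s \<in> real_simple_zeros P" "r \<noteq> s"
  obtains z where "linear_zero (P * linear_factor (of_real r)) z" "coq_re z = (r + s) / 2"
proof -
  let ?Pr = "P * linear_factor (of_real r)"
  let ?q = "coqpoly_eval P (of_real s)"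
  define h where "h = (s - r) / 2"
  have "h \<noteq> 0"
    using assms(3) by (simp add: h_def)
  define z where "z u = of_real ((r + s) / 2) + h *\<^sub>R u" for u :: coquat
  obtain u v where u: "coq_re u = 0" "coq_dv u = - 1" "?q * u = - ?q"
    and v: "coq_re v = 0" "coq_dv v = - 1" "?q * v = - ?q" and "u \<noteq> v"
    using null_coquat_eigen eval_at_real_simple_zero[OF assms(1,2)] by metis
  have neg_u: "coq_re (- u) = 0" "coq_dv (- u) = - 1"
    using u by (simp_all add: coq_dv_def)
  have dv_z: "coq_dv (z x) = h\<^sup>2 * coq_dv x" for x
    by (simp add: z_def coq_dv_def power_mult_distrib right_diff_distrib)
  have re_z: "coq_re (z x) = (r + s) / 2" if "coq_re x = 0" for x
    using that by (simp add: z_def)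
  have zero_iff: "coq_zero ?Pr (z x) \<longleftrightarrow> ?q * (x + 1) = 0"
    if "coq_re x = 0" "coq_dv x = - 1" for x
    using eval_on_real_pair_class[OF that, of P r s] \<open>h \<noteq> 0\<close>
    by (simp add: coq_zero_def z_def flip: h_def)
  have "coq_zero ?Pr (z u)" "coq_zero ?Pr (z v)"
    using u v by (simp_all add: zero_iff distrib_left)
  \<comment> \<open>The zero at \<open>v\<close> rules out isolated; this non-zero in the same class
    rules out hyperboloidal.\<close>
  moreover have "\<not> coq_zero ?Pr (z (- u))"
  proof -
    have "?q * (- u + 1) = 2 *\<^sub>R ?q"
      using u by (simp add: right_diff_distrib scaleR_2)
    then show ?thesis
      using eval_at_real_simple_zero(1)[OF assms(1,2)]
      unfolding zero_iff[OF neg_u] by simp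
  qed
  moreover have "z v \<noteq> z u"
    using \<open>u \<noteq> v\<close> \<open>h \<noteq> 0\<close> by (simp add: z_def)
  moreover have "z v \<in> qsim_class (z u)" "z (- u) \<in> qsim_class (z u)"
    using u v neg_u by (simp_all add: qsim_class_def re_z dv_z)
  ultimately have "linear_zero ?Pr (z u)"
    unfolding linear_zero_def isolated_zero_def hyperboloidal_zero_def by blast
  with re_z u(1) that show thesis by blast
qed

theorem theorem3p16:
  fixes P :: coqpoly and n m :: nat and rt :: "nat \<Rightarrow> real" and r :: real
  assumes "monic_of_degree n P"
    and "bij_betw rt {1..m} (real_simple_zeros P)"
    and "m \<le> 2 * n"
    and "\<forall>i\<in>{1..m}. r \<noteq> rt i"
  shows "at_least_linear_zeros m (P * linear_factor (of_real r))"
proof -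
  have "\<exists>z. linear_zero (P * linear_factor (of_real r)) z \<and> coq_re z = (r + rt i) / 2"
    if "i \<in> {1..m}" for i
  proof -
    have "rt i \<in> real_simple_zeros P" "r \<noteq> rt i"
      using assms(2,4) that by (auto dest: bij_betwE)
    then show ?thesis
      using linear_zero_at_simple_zero[OF assms(1)] by metis
  qed
  then obtain z where z: "linear_zero (P * linear_factor (of_real r)) (z i)"
      "coq_re (z i) = (r + rt i) / 2" if "i \<in> {1..m}" for i
    by metis
  have "inj_on (\<lambda>i. qsim_class (z i)) {1..m}"
  proof (rule inj_onI)
    fix i j assume ij: "i \<in> {1..m}" "j \<in> {1..m}" and "qsim_class (z i) = qsim_class (z j)"
    then have "z i \<in> qsim_class (z j)"
      by (auto simp: qsim_class_def)
    \<comment> \<open>A class determines the real part (r + \<open>rt i\<close>)/2, and thereby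
      \<open>rt i\<close>.\<close>
    then have "rt i = rt j"
      using z(2)[OF ij(1)] z(2)[OF ij(2)] by (simp add: qsim_class_def)
    then show "i = j"
      using assms(2) ij by (auto simp: bij_betw_def dest: inj_onD)
  qed
  then have "card ((\<lambda>i. qsim_class (z i)) ` {1..m}) = m"
    by (simp add: card_image)
  moreover have "(\<lambda>i. qsim_class (z i)) ` {1..m}
      \<subseteq> {qsim_class w | w. linear_zero (P * linear_factor (of_real r)) w}"
    using z(1) by blast
  ultimately show ?thesis
    unfolding at_least_linear_zeros_def
    by (intro exI[of _ "(\<lambda>i. qsim_class (z i)) ` {1..m}"] conjI finite_imageI finite_atLeastAtMost)
qed

end
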